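(* Let $k$ be a constant in $[0,1]$ and consider the second-order ordinary differential equation for $y=y(x)$ $$\dot y\sin x\cos y\,(k-2\cos^2x\cos^2y)+\ddot y\cos x\cos y\,(\cos^2x\cos^2y-k)+k\sec x\sin y+k\,\dot y^2\cos x\sin y-\dot y^3\cos^4x\sin x\cos^3y=0,$$ where dots denote differentiation with respect to $x$. Upon replacement of the variables $(x,y)$ with the canonical coordinates $$\tau=\arctan(\cot x\,\sin y),\qquad \omega=\cos x\cos y$$ of the symmetry $\chi_3=\sin y\,\frac{\partial}{\partial x}-\cos y\tan x\,\frac{\partial}{\partial y}$ which it accommodates, this equation reduces to the first-order equation for $\omega=\omega(\tau)$ $$\omega'(\tau)=(1-\omega^2)\tan\left[\pm\arccos\sqrt{\frac{\alpha-(\omega^2\cos^2\tau+\sin^2\tau)}{\left(\frac{k}{\omega^2}-1\right)(\omega^2\cos^2\tau+\sin^2\tau)}}+\arctan\left(\frac{\omega}{\tan\tau}\right)\right],$$ where $\alpha$ is a constant of integration arising in the course of the simplification.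
   Context: The second-order equation is the one for geodesics of the unit 3-sphere $S^3\subset\mathbb R^4$ in the hyperspherical coordinates $(x,y,v)\mapsto(\cos x\cos y\cos v,\ \cos x\cos y\sin v,\ \cos x\sin y,\ \sin x)$. It is derived from the arclength Lagrangian $\Lambda=\sqrt{1+\cos^2x\,\dot y^2+\cos^2x\cos^2y\,\dot v^2}$ by substituting the outcome of the Euler–Lagrange equation $\Lambda_v-\frac{d}{dx}(\Lambda_{\dot v})=0$ into the Euler–Lagrange equation $\Lambda_y-\frac{d}{dx}(\Lambda_{\dot y})=0$. Here $\omega$ is the invariant of $\chi_3$ and $\tau$ is the other canonical coordinate: along the one-parameter group generated by $\chi_3$, with parameter $\lambda$, $\omega$ is unchanged and $\tau$ becomes $\tau+\lambda$.
   Formalization: With the stated χ₃ one has χ₃τ = −1, so τ becomes τ−λ rather than τ+λ; the canonical-coordinate claim is therefore stated for −χ₃. The converse of the reduction excludes y constant on a subinterval, which solves the first-order equation but not in general the second-order one. *)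

theory Defs
  imports "HOL-Analysis.Analysis"
begin

section \<open>The second-order equation\<close>

text \<open>Here \<open>p\<close> and \<open>q\<close> stand for the first and second derivative of \<open>y\<close> at \<open>x\<close>,
  and \<open>k / cos x\<close> is \<open>k sec x\<close>.\<close>

definition geodesic_lhs :: "real \<Rightarrow> real \<Rightarrow> real \<Rightarrow> real \<Rightarrow> real \<Rightarrow> real" where
  "geodesic_lhs k x y p q =
     p * sin x * cos y * (k - 2 * (cos x)\<^sup>2 * (cos y)\<^sup>2)
     + q * cos x * cos y * ((cos x)\<^sup>2 * (cos y)\<^sup>2 - k)
     + (k / cos x) * sin y
     + k * p\<^sup>2 * cos x * sin y
     - p ^ 3 * (cos x) ^ 4 * sin x * (cos y) ^ 3"

definition solves_geodesic ::
  "real \<Rightarrow> real set \<Rightarrow> (real \<Rightarrow> real) \<Rightarrow> (real \<Rightarrow> real) \<Rightarrow> (real \<Rightarrow> real) \<Rightarrow> bool" where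
  "solves_geodesic k I y y1 y2 \<longleftrightarrow> (\<forall>x\<in>I. geodesic_lhs k x (y x) (y1 x) (y2 x) = 0)"


section \<open>Lie point symmetries and canonical coordinates\<close>

text \<open>Coefficients of the first and second prolongation of the vector field
  \<open>\<xi> \<partial>/\<partial>x + \<eta> \<partial>/\<partial>y\<close>, namely \<open>\<eta>\<^sub>1 = D \<eta> - p D \<xi>\<close> and \<open>\<eta>\<^sub>2 = D \<eta>\<^sub>1 - q D \<xi>\<close> with
  the total derivative \<open>D = \<partial>/\<partial>x + p \<partial>/\<partial>y + q \<partial>/\<partial>p\<close>.\<close>

definition total_deriv :: "(real \<Rightarrow> real \<Rightarrow> real) \<Rightarrow> real \<Rightarrow> real \<Rightarrow> real \<Rightarrow> real" where
  "total_deriv f x y p = deriv (\<lambda>u. f u y) x + p * deriv (\<lambda>u. f x u) y"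

definition prolong1 ::
  "(real \<Rightarrow> real \<Rightarrow> real) \<Rightarrow> (real \<Rightarrow> real \<Rightarrow> real) \<Rightarrow> real \<Rightarrow> real \<Rightarrow> real \<Rightarrow> real" where
  "prolong1 \<xi> \<eta> x y p = total_deriv \<eta> x y p - p * total_deriv \<xi> x y p"

definition prolong2 ::
  "(real \<Rightarrow> real \<Rightarrow> real) \<Rightarrow> (real \<Rightarrow> real \<Rightarrow> real) \<Rightarrow> real \<Rightarrow> real \<Rightarrow> real \<Rightarrow> real \<Rightarrow> real" where
  "prolong2 \<xi> \<eta> x y p q =
     deriv (\<lambda>u. prolong1 \<xi> \<eta> u y p) x
     + p * deriv (\<lambda>u. prolong1 \<xi> \<eta> x u p) y
     + q * deriv (\<lambda>u. prolong1 \<xi> \<eta> x y u) p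
     - q * total_deriv \<xi> x y p"

text \<open>Lie's infinitesimal criterion for the equation \<open>F x y y' y'' = 0\<close> over the domain \<open>D\<close>:
  the second prolongation annihilates \<open>F\<close> wherever \<open>F\<close> vanishes.\<close>

definition lie_point_symmetry ::
  "(real \<times> real) set \<Rightarrow> (real \<Rightarrow> real \<Rightarrow> real \<Rightarrow> real \<Rightarrow> real) \<Rightarrow>
   (real \<Rightarrow> real \<Rightarrow> real) \<Rightarrow> (real \<Rightarrow> real \<Rightarrow> real) \<Rightarrow> bool" where
  "lie_point_symmetry D F \<xi> \<eta> \<longleftrightarrow>
     (\<forall>x y p q. (x, y) \<in> D \<and> F x y p q = 0 \<longrightarrow>
        \<xi> x y * deriv (\<lambda>u. F u y p q) x
        + \<eta> x y * deriv (\<lambda>u. F x u p q) y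
        + prolong1 \<xi> \<eta> x y p * deriv (\<lambda>u. F x y u q) p
        + prolong2 \<xi> \<eta> x y p q * deriv (\<lambda>u. F x y p u) q = 0)"

definition integral_curve ::
  "(real \<times> real) set \<Rightarrow> (real \<Rightarrow> real \<Rightarrow> real) \<Rightarrow> (real \<Rightarrow> real \<Rightarrow> real) \<Rightarrow>
   real set \<Rightarrow> (real \<Rightarrow> real) \<Rightarrow> (real \<Rightarrow> real) \<Rightarrow> bool" where
  "integral_curve D \<xi> \<eta> L X Y \<longleftrightarrow>
     open L \<and> is_interval L \<and> 0 \<in> L \<and>
     (\<forall>l\<in>L. (X l, Y l) \<in> D \<and>
        (X has_real_derivative \<xi> (X l) (Y l)) (at l) \<and>
        (Y has_real_derivative \<eta> (X l) (Y l)) (at l))"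

text \<open>\<open>(T, W)\<close> are local coordinates on \<open>D\<close> (nonvanishing Jacobian) in which the one-parameter
  group generated by the vector field acts by \<open>(T, W) \<mapsto> (T + l, W)\<close>.\<close>

definition canonical_coordinates ::
  "(real \<times> real) set \<Rightarrow> (real \<Rightarrow> real \<Rightarrow> real) \<Rightarrow> (real \<Rightarrow> real \<Rightarrow> real) \<Rightarrow>
   (real \<Rightarrow> real \<Rightarrow> real) \<Rightarrow> (real \<Rightarrow> real \<Rightarrow> real) \<Rightarrow> bool" where
  "canonical_coordinates D \<xi> \<eta> T W \<longleftrightarrow>
     (\<forall>x y. (x, y) \<in> D \<longrightarrow>
        deriv (\<lambda>u. T u y) x * deriv (\<lambda>u. W x u) y
        - deriv (\<lambda>u. T x u) y * deriv (\<lambda>u. W u y) x \<noteq> 0) \<and>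
     (\<forall>L X Y. integral_curve D \<xi> \<eta> L X Y \<longrightarrow>
        (\<forall>l\<in>L. W (X l) (Y l) = W (X 0) (Y 0) \<and>
               T (X l) (Y l) = T (X 0) (Y 0) + l))"

text \<open>The components of \<open>\<chi>\<^sub>3\<close>. One computes \<open>\<chi>\<^sub>3 \<omega> = 0\<close> and \<open>\<chi>\<^sub>3 \<tau> = -1\<close>, so it is the
  generator \<open>-\<chi>\<^sub>3\<close> of the same one-parameter group (parameter reversed) that translates \<open>\<tau>\<close> by
  \<open>+l\<close> and for which \<open>(\<tau>, \<omega>)\<close> are canonical in the above normalisation.\<close>

definition xi3 :: "real \<Rightarrow> real \<Rightarrow> real" where
  "xi3 x y = sin y"

definition eta3 :: "real \<Rightarrow> real \<Rightarrow> real" where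
  "eta3 x y = - cos y * tan x"

definition tau :: "real \<Rightarrow> real \<Rightarrow> real" where
  "tau x y = arctan (cot x * sin y)"

definition omega :: "real \<Rightarrow> real \<Rightarrow> real" where
  "omega x y = cos x * cos y"


section \<open>Change of variables along a curve\<close>

text \<open>A twice differentiable curve \<open>y = y(x)\<close> in the region where all expressions in the two
  equations are defined, and along which \<open>\<tau>\<close> may serve as independent variable.\<close>

definition admissible_curve ::
  "real \<Rightarrow> real set \<Rightarrow> (real \<Rightarrow> real) \<Rightarrow> (real \<Rightarrow> real) \<Rightarrow> (real \<Rightarrow> real) \<Rightarrow> bool" where
  "admissible_curve k I y y1 y2 \<longleftrightarrow>
     open I \<and> is_interval I \<and>
     (\<forall>x\<in>I. (y has_real_derivative y1 x) (at x) \<and>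
            (y1 has_real_derivative y2 x) (at x) \<and>
            sin x \<noteq> 0 \<and> cos x \<noteq> 0 \<and> sin (y x) \<noteq> 0 \<and> cos (y x) \<noteq> 0 \<and>
            (omega x (y x))\<^sup>2 \<noteq> k \<and>
            deriv (\<lambda>u. tau u (y u)) x \<noteq> 0)"

definition tau_image :: "real set \<Rightarrow> (real \<Rightarrow> real) \<Rightarrow> real set" where
  "tau_image I y = (\<lambda>x. tau x (y x)) ` I"

definition omega_of_tau :: "real set \<Rightarrow> (real \<Rightarrow> real) \<Rightarrow> real \<Rightarrow> real" where
  "omega_of_tau I y t = (let x = the_inv_into I (\<lambda>u. tau u (y u)) t in omega x (y x))"


section \<open>The reduced first-order equation\<close>

definition reduced_radicand :: "real \<Rightarrow> real \<Rightarrow> real \<Rightarrow> real \<Rightarrow> real" where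
  "reduced_radicand k \<alpha> t w =
     (\<alpha> - (w\<^sup>2 * (cos t)\<^sup>2 + (sin t)\<^sup>2)) /
     ((k / w\<^sup>2 - 1) * (w\<^sup>2 * (cos t)\<^sup>2 + (sin t)\<^sup>2))"

definition reduced_angle :: "real \<Rightarrow> real \<Rightarrow> real \<Rightarrow> real \<Rightarrow> real \<Rightarrow> real" where
  "reduced_angle k \<alpha> s t w =
     s * arccos (sqrt (reduced_radicand k \<alpha> t w)) + arctan (w / tan t)"

text \<open>The equation at the point \<open>t\<close>, with \<open>s\<close> the sign chosen for \<open>\<plusminus>\<close>. All conjuncts but the last
  one say that its right-hand side is defined there, which the totalised operations of HOL would
  otherwise hide. Note that in HOL \<open>tan t \<noteq> 0\<close> also excludes \<open>cos t = 0\<close>.\<close>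

definition reduced_eq_at :: "real \<Rightarrow> real \<Rightarrow> real \<Rightarrow> (real \<Rightarrow> real) \<Rightarrow> real \<Rightarrow> bool" where
  "reduced_eq_at k \<alpha> s w t \<longleftrightarrow>
     tan t \<noteq> 0 \<and> w t \<noteq> 0 \<and> (w t)\<^sup>2 \<noteq> k \<and>
     (w t)\<^sup>2 * (cos t)\<^sup>2 + (sin t)\<^sup>2 \<noteq> 0 \<and>
     0 \<le> reduced_radicand k \<alpha> t (w t) \<and> reduced_radicand k \<alpha> t (w t) \<le> 1 \<and>
     cos (reduced_angle k \<alpha> s t (w t)) \<noteq> 0 \<and>
     (w has_real_derivative (1 - (w t)\<^sup>2) * tan (reduced_angle k \<alpha> s t (w t))) (at t)"

text \<open>The sign \<open>\<plusminus>\<close> is that of \<open>y'\<close> up to a factor that is constant along the curve, so it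
  switches where \<open>y'\<close> changes sign: \<open>solves_reduced\<close> lets it depend on the point, while
  \<open>solves_reduced_sign\<close> fixes it.\<close>

definition solves_reduced_sign ::
  "real \<Rightarrow> real \<Rightarrow> real \<Rightarrow> real set \<Rightarrow> (real \<Rightarrow> real) \<Rightarrow> bool" where
  "solves_reduced_sign k \<alpha> s J w \<longleftrightarrow> (\<forall>t\<in>J. reduced_eq_at k \<alpha> s w t)"

definition solves_reduced :: "real \<Rightarrow> real \<Rightarrow> real set \<Rightarrow> (real \<Rightarrow> real) \<Rightarrow> bool" where
  "solves_reduced k \<alpha> J w \<longleftrightarrow> (\<forall>t\<in>J. \<exists>s\<in>{1, -1}. reduced_eq_at k \<alpha> s w t)"

text \<open>The constant functions \<open>y\<close> satisfy the reduced equation with \<open>\<alpha> = k / cos\<^sup>2 y\<close> (the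
  \<open>arccos\<close> term vanishes) without solving the second-order equation in general; they are the
  singular solutions to be excluded when passing back.\<close>

definition nowhere_locally_constant :: "real set \<Rightarrow> (real \<Rightarrow> real) \<Rightarrow> bool" where
  "nowhere_locally_constant I y \<longleftrightarrow>
     (\<forall>a b. a < b \<and> {a<..<b} \<subseteq> I \<longrightarrow> \<not> y constant_on {a<..<b})"

end

theory Submission
  imports Defs
begin

text \<open>One has \<open>\<omega>\<^sup>2 cos\<^sup>2 \<tau> + sin\<^sup>2 \<tau> = cos\<^sup>2 x\<close> and \<open>\<omega> / tan \<tau> = sin x cot y\<close>, and the chain rule gives
  \<open>\<omega>'(\<tau>) = (1 - \<omega>\<^sup>2) tan (arctan (y' cos x) + arctan (sin x cot y))\<close> along a curve. So the reduced equation says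
  that \<open>arctan (y' cos x)\<close> is \<open>\<plusminus>arccos\<close> of the square root of the radicand, that is,
  \<open>\<alpha> = cos\<^sup>2 x + (k / cos\<^sup>2 y - cos\<^sup>2 x) / (1 + y'\<^sup>2 cos\<^sup>2 x)\<close>. The derivative of this expression along the curve is the
  left-hand side of the second-order equation times \<open>y'\<close> and a nonvanishing factor, hence it is a first
  integral. Conversely, constancy yields the second-order equation wherever \<open>y' \<noteq> 0\<close>, and by
  continuity everywhere unless \<open>y\<close> is locally constant somewhere.\<close>


section \<open>The symmetry\<close>

lemma deriv_xi3:
  "deriv (\<lambda>u. xi3 u y) x = 0" "deriv (\<lambda>u. xi3 x u) y = cos y"
  unfolding xi3_def
  by (auto intro!: DERIV_imp_deriv derivative_eq_intros)

lemma deriv_eta3: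
  assumes "cos x \<noteq> 0"
  shows "deriv (\<lambda>u. eta3 u y) x = - cos y / (cos x)\<^sup>2" (is ?dx)
    and "deriv (\<lambda>u. eta3 x u) y = sin y * tan x" (is ?dy)
proof -
  show ?dx
    by (rule DERIV_imp_deriv) (use assms in \<open>auto simp: eta3_def field_simps intro!: derivative_eq_intros\<close>)
  show ?dy
    by (rule DERIV_imp_deriv) (use assms in \<open>auto simp: eta3_def intro!: derivative_eq_intros\<close>)
qed

lemma total_deriv_xi3: "total_deriv xi3 x y p = p * cos y"
  by (simp add: total_deriv_def deriv_xi3)

lemma prolong1_chi3:
  assumes "cos x \<noteq> 0"
  shows "prolong1 xi3 eta3 x y p = - cos y / (cos x)\<^sup>2 + p * sin y * tan x - p\<^sup>2 * cos y"
  using assms unfolding prolong1_def total_deriv_xi3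
  by (simp add: total_deriv_def deriv_eta3 power2_eq_square)

lemma prolong2_chi3:
  assumes c: "cos x \<noteq> 0"
  shows "prolong2 xi3 eta3 x y p q =
    - 2 * cos y * sin x / (cos x) ^ 3 + 2 * p * sin y / (cos x)\<^sup>2 + p\<^sup>2 * cos y * tan x + p ^ 3 * sin y
    + q * (sin y * tan x - 3 * p * cos y)"
proof -
  \<comment> \<open>The closed form of \<open>prolong1\<close> holds only where the cosine is
    nonzero; to differentiate it at \<open>x\<close> it must hold on a whole neighbourhood.\<close>
  have "open {u::real. cos u \<noteq> 0}"
    by (intro open_Collect_neq continuous_intros)
  then have ev: "\<forall>\<^sub>F u in nhds x. cos u \<noteq> 0"
    using c eventually_nhds_in_open by fastforce
  have "deriv (\<lambda>u. prolong1 xi3 eta3 u y p) x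
      = deriv (\<lambda>u. - cos y / (cos u)\<^sup>2 + p * sin y * tan u - p\<^sup>2 * cos y) x"
    by (rule deriv_cong_ev[OF eventually_mono[OF ev]]) (simp_all add: prolong1_chi3)
  also have "\<dots> = - 2 * cos y * sin x / (cos x) ^ 3 + p * sin y / (cos x)\<^sup>2"
    by (rule DERIV_imp_deriv)
      (use c in \<open>auto intro!: derivative_eq_intros simp: field_simps power2_eq_square power3_eq_cube\<close>)
  finally have dx: "deriv (\<lambda>u. prolong1 xi3 eta3 u y p) x = \<dots>" .
  have dy: "deriv (\<lambda>u. prolong1 xi3 eta3 x u p) y = sin y / (cos x)\<^sup>2 + p * cos y * tan x + p\<^sup>2 * sin y"
    unfolding prolong1_chi3[OF c]
    by (rule DERIV_imp_deriv) (use c in \<open>auto intro!: derivative_eq_intros simp: field_simps eval_nat_numeral\<close>)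
  have dp: "deriv (\<lambda>u. prolong1 xi3 eta3 x y u) p = sin y * tan x - 2 * p * cos y"
    unfolding prolong1_chi3[OF c]
    by (auto intro!: DERIV_imp_deriv derivative_eq_intros)
  show ?thesis
    unfolding prolong2_def dx dy dp total_deriv_xi3
    by (simp add: algebra_simps power2_eq_square power3_eq_cube)
qed

section \<open>Lie's criterion for the second-order equation\<close>

lemma deriv_geodesic_lhs:
  assumes "cos x \<noteq> 0"
  shows "deriv (\<lambda>u. geodesic_lhs k u y p q) x =
      p * cos y * (cos x * (k - 2 * (cos x)\<^sup>2 * (cos y)\<^sup>2) + 4 * cos x * (sin x)\<^sup>2 * (cos y)\<^sup>2)
      + q * cos y * (k * sin x - 3 * (cos x)\<^sup>2 * sin x * (cos y)\<^sup>2)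
      + k * sin x * sin y / (cos x)\<^sup>2 - k * p\<^sup>2 * sin x * sin y
      - p ^ 3 * (cos y) ^ 3 * ((cos x) ^ 5 - 4 * (cos x) ^ 3 * (sin x)\<^sup>2)"
    and "deriv (\<lambda>u. geodesic_lhs k x u p q) y =
      p * sin x * sin y * (6 * (cos x)\<^sup>2 * (cos y)\<^sup>2 - k)
      + q * cos x * sin y * (k - 3 * (cos x)\<^sup>2 * (cos y)\<^sup>2)
      + k * cos y / cos x + k * p\<^sup>2 * cos x * cos y
      + 3 * p ^ 3 * (cos x) ^ 4 * sin x * (cos y)\<^sup>2 * sin y"
    and "deriv (\<lambda>u. geodesic_lhs k x y u q) p =
      sin x * cos y * (k - 2 * (cos x)\<^sup>2 * (cos y)\<^sup>2) + 2 * k * p * cos x * sin y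
      - 3 * p\<^sup>2 * (cos x) ^ 4 * sin x * (cos y) ^ 3"
    and "deriv (\<lambda>u. geodesic_lhs k x y p u) q = cos x * cos y * ((cos x)\<^sup>2 * (cos y)\<^sup>2 - k)"
  unfolding geodesic_lhs_def using assms
     apply -
     apply (rule DERIV_imp_deriv, (rule derivative_eq_intros | simp)+, simp add: field_simps, algebra)
    apply (rule DERIV_imp_deriv, (rule derivative_eq_intros | simp)+, simp add: field_simps, algebra)
   apply (rule DERIV_imp_deriv, (rule derivative_eq_intros | simp)+)
  apply (rule DERIV_imp_deriv, (rule derivative_eq_intros | simp)+)
  done

text \<open>Both sides of the symmetry condition with \<open>a = cos x\<close>, \<open>b = sec x\<close>, \<open>c = cos y\<close>, \<open>d = sin y\<close>,
  \<open>r = sin x\<close>. In this naming the simplifier's ordering of monomials keeps \<open>a\<close> and \<open>b\<close> adjacent, so the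
  three relations act as rewrite rules.\<close>

lemma chi3_identity:
  fixes a b c d k p q r :: real
  assumes "a * b = 1" "r\<^sup>2 + a\<^sup>2 = 1" "d\<^sup>2 + c\<^sup>2 = 1"
  shows "d * (p * c * (a * (k - 2 * a\<^sup>2 * c\<^sup>2) + 4 * a * r\<^sup>2 * c\<^sup>2)
      + q * c * (k * r - 3 * a\<^sup>2 * r * c\<^sup>2)
      + k * r * d * b\<^sup>2 - k * p\<^sup>2 * r * d
      - p ^ 3 * c ^ 3 * (a ^ 5 - 4 * a ^ 3 * r\<^sup>2))
    - c * (r * b) * (p * r * d * (6 * a\<^sup>2 * c\<^sup>2 - k)
      + q * a * d * (k - 3 * a\<^sup>2 * c\<^sup>2)
      + k * c * b + k * p\<^sup>2 * a * c
      + 3 * p ^ 3 * a ^ 4 * r * c\<^sup>2 * d)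
    + (- c * b\<^sup>2 + p * d * (r * b) - p\<^sup>2 * c) * (r * c * (k - 2 * a\<^sup>2 * c\<^sup>2) + 2 * k * p * a * d
      - 3 * p\<^sup>2 * a ^ 4 * r * c ^ 3)
    + (- 2 * c * r * b ^ 3 + 2 * p * d * b\<^sup>2 + p\<^sup>2 * c * (r * b) + p ^ 3 * d
    + q * (d * (r * b) - 3 * p * c)) * (a * c * (a\<^sup>2 * c\<^sup>2 - k))
   = (d * (r * b) - 3 * p * c) * (p * r * c * (k - 2 * a\<^sup>2 * c\<^sup>2)
     + q * a * c * (a\<^sup>2 * c\<^sup>2 - k)
     + k * b * d
     + k * p\<^sup>2 * a * d
     - p ^ 3 * a ^ 4 * r * c ^ 3)"
proof -
  have 1: "a * (b * z) = z" for z using assms by algebra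
  have 2: "r * r = 1 - a * a" "r * (r * z) = z - a * (a * z)" for z using assms by algebra+
  have 3: "d * d = 1 - c * c" "d * (d * z) = z - c * (c * z)" for z using assms by algebra+
  show ?thesis
    by (simp add: eval_nat_numeral algebra_simps 1 2 3 assms(1))
qed
text \<open>The prolonged field reproduces the left-hand side up to a factor, for all
  \<open>p\<close> and \<open>q\<close>. So the result vanishes wherever the equation holds, which
  is Lie's criterion.\<close>

lemma chi3_prolonged_geodesic_lhs:
  assumes c: "cos x \<noteq> 0"
  shows "xi3 x y * deriv (\<lambda>u. geodesic_lhs k u y p q) x
    + eta3 x y * deriv (\<lambda>u. geodesic_lhs k x u p q) y
    + prolong1 xi3 eta3 x y p * deriv (\<lambda>u. geodesic_lhs k x y u q) p
    + prolong2 xi3 eta3 x y p q * deriv (\<lambda>u. geodesic_lhs k x y p u) q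
    = (sin y * tan x - 3 * p * cos y) * geodesic_lhs k x y p q"
proof -
  \<comment> \<open>Once division by \<open>cos x\<close> is multiplication by \<open>b\<close>, the
    claim is the polynomial identity \<open>chi3_identity\<close>.\<close>
  define b where "b = 1 / cos x"
  have b: "cos x * b = 1" using c by (simp add: b_def)
  have d: "z / cos x ^ n = z * b ^ n" "z / cos x = z * b" for z n
    by (simp_all add: b_def divide_inverse power_inverse)
  show ?thesis
    unfolding prolong1_chi3[OF c] prolong2_chi3[OF c] deriv_geodesic_lhs[OF c]
    unfolding xi3_def eta3_def tan_def d geodesic_lhs_def
    using chi3_identity[OF b sin_cos_squared_add[of x] sin_cos_squared_add[of y], where k = k and p = p and q = q]
    by (simp add: mult.assoc)
qed


section \<open>Canonical coordinates\<close>

text \<open>On the unit sphere \<omega>^2 is the sum of the squares of the first two Cartesian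
  coordinates, hence its complement is the sum of the other two squares.\<close>

lemma one_minus_omega_sq:
  "1 - (omega x y)\<^sup>2 = (sin x)\<^sup>2 + (cos x)\<^sup>2 * (sin y)\<^sup>2"
  unfolding omega_def using sin_cos_squared_add[of x] sin_cos_squared_add[of y] by algebra

lemma one_minus_omega_sq_pos:
  assumes "sin x \<noteq> 0"
  shows "1 - (omega x y)\<^sup>2 > 0"
  unfolding one_minus_omega_sq using assms
  by (simp add: add_pos_nonneg)

text \<open>Stated for a parametrised curve so that it yields the partial derivatives of \<tau>, its
  derivative along the flow and its derivative along a graph. The denominator comes from 1 + cot^2 x
  sin^2 y = (1 - \<omega>^2) / sin^2 x.\<close>

lemma DERIV_tau_curve:
  assumes "(X has_real_derivative a) (at l)" "(Y has_real_derivative b) (at l)" "sin (X l) \<noteq> 0"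
  shows "((\<lambda>l. tau (X l) (Y l)) has_real_derivative
    (sin (X l) * cos (X l) * cos (Y l) * b - sin (Y l) * a) / (1 - (omega (X l) (Y l))\<^sup>2)) (at l)"
proof -
  let ?u = "cos (X l) / sin (X l) * sin (Y l)"
  have "1 + ?u\<^sup>2 = (1 - (omega (X l) (Y l))\<^sup>2) / (sin (X l))\<^sup>2"
    unfolding one_minus_omega_sq using assms(3) by (simp add: field_simps)
  moreover have "1 - (omega (X l) (Y l))\<^sup>2 \<noteq> 0"
    using one_minus_omega_sq_pos[OF assms(3), of "Y l"] by simp
  ultimately have e: "inverse (1 + ?u\<^sup>2) * z = z * (sin (X l))\<^sup>2 / (1 - (omega (X l) (Y l))\<^sup>2)" for z
    by simp
  have "((\<lambda>l. arctan (cos (X l) / sin (X l) * sin (Y l))) has_real_derivative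
      inverse (1 + ?u\<^sup>2) * ((- sin (X l) * a * sin (X l) - cos (X l) * (cos (X l) * a)) / (sin (X l) * sin (X l)) * sin (Y l)
         + cos (X l) / sin (X l) * (cos (Y l) * b))) (at l)"
    by (rule derivative_eq_intros assms refl | simp add: assms)+
  moreover have q: "- sin (X l) * a * sin (X l) - cos (X l) * (cos (X l) * a) = - a"
    using sin_cos_squared_add[of "X l"] by algebra
  moreover have "((- sin (X l) * a * sin (X l) - cos (X l) * (cos (X l) * a)) / (sin (X l) * sin (X l)) * sin (Y l)
         + cos (X l) / sin (X l) * (cos (Y l) * b)) * (sin (X l))\<^sup>2
      = sin (X l) * cos (X l) * cos (Y l) * b - sin (Y l) * a"
    unfolding q using assms(3) by (simp add: field_simps power2_eq_square)
  ultimately show ?thesis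
    unfolding e by (simp add: tau_def cot_def)
qed

lemma DERIV_omega_curve:
  assumes "(X has_real_derivative a) (at l)" "(Y has_real_derivative b) (at l)"
  shows "((\<lambda>l. omega (X l) (Y l)) has_real_derivative
    - sin (X l) * cos (Y l) * a - cos (X l) * sin (Y l) * b) (at l)"
  unfolding omega_def using assms
  by (auto intro!: derivative_eq_intros)

text \<open>Subtracting the linear part leaves derivative zero on a connected set. Along the flow it
  is applied to \<omega> with \<open>c = 0\<close> and to \<tau> with \<open>c = 1\<close>.\<close>

lemma eq_linear_if_DERIV_const:
  fixes f :: "real \<Rightarrow> real"
  assumes L: "open L" "is_interval L"
    and d: "\<And>l. l \<in> L \<Longrightarrow> (f has_real_derivative c) (at l)"
    and ab: "a \<in> L" "b \<in> L"
  shows "f b = f a + c * (b - a)"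
proof -
  have "((\<lambda>l. f l - c * l) has_real_derivative c - c * 1) (at l)" if "l \<in> L" for l
    by (intro derivative_intros d that DERIV_cmult)
  then have "(\<lambda>l. f l - c * l) constant_on L"
    using L by (intro has_field_derivative_0_imp_constant_on) (auto simp: is_interval_connected)
  then have "f b - c * b = f a - c * a"
    using ab unfolding constant_on_def by metis
  then show ?thesis by (simp add: algebra_simps)
qed

lemma canonical_coordinates_tau_omega:
  "canonical_coordinates {(x, y). sin x \<noteq> 0 \<and> cos x \<noteq> 0}
     (\<lambda>x y. - xi3 x y) (\<lambda>x y. - eta3 x y) tau omega"
  unfolding canonical_coordinates_def
proof (intro conjI allI impI ballI, goal_cases)
  case (1 x y)
  let ?D = "1 - (omega x y)\<^sup>2"
  have D: "?D \<noteq> 0" using one_minus_omega_sq_pos[of x y] 1 by auto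
  have "deriv (\<lambda>u. tau u y) x = - sin y / ?D" "deriv (\<lambda>u. tau x u) y = sin x * cos x * cos y / ?D"
    using DERIV_imp_deriv[OF DERIV_tau_curve[where X = "\<lambda>u. u" and Y = "\<lambda>u. y", OF DERIV_ident DERIV_const]]
      DERIV_imp_deriv[OF DERIV_tau_curve[where X = "\<lambda>u. x" and Y = "\<lambda>u. u", OF DERIV_const DERIV_ident]] 1
    by auto
  moreover have "deriv (\<lambda>u. omega u y) x = - sin x * cos y" "deriv (\<lambda>u. omega x u) y = - cos x * sin y"
    using DERIV_imp_deriv[OF DERIV_omega_curve[where X = "\<lambda>u. u" and Y = "\<lambda>u. y", OF DERIV_ident DERIV_const]]
      DERIV_imp_deriv[OF DERIV_omega_curve[where X = "\<lambda>u. x" and Y = "\<lambda>u. u", OF DERIV_const DERIV_ident]]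
    by auto
  \<comment> \<open>The numerator of the Jacobian contains its denominator \<open>?D\<close>, so the
    Jacobian is just \<open>cos x\<close>.\<close>
  moreover have "- sin y * (- cos x * sin y) - sin x * cos x * cos y * (- sin x * cos y) = cos x * ?D"
    unfolding omega_def using sin_cos_squared_add[of x] sin_cos_squared_add[of y] by algebra
  ultimately have "deriv (\<lambda>u. tau u y) x * deriv (\<lambda>u. omega x u) y
      - deriv (\<lambda>u. tau x u) y * deriv (\<lambda>u. omega u y) x = cos x"
    using D by (simp only: times_divide_eq_left diff_divide_distrib[symmetric] nonzero_mult_div_cancel_right not_False_eq_True simp_thms)
  then show ?case using 1 by simp
next
  case (2 L X Y l)
  then have L: "open L" "is_interval L" "0 \<in> L" unfolding integral_curve_def by auto
  have "((\<lambda>l. omega (X l) (Y l)) has_real_derivative 0) (at l)" if "l \<in> L" for l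
  proof -
    have c: "cos (X l) \<noteq> 0" and d: "(X has_real_derivative - xi3 (X l) (Y l)) (at l)"
        "(Y has_real_derivative - eta3 (X l) (Y l)) (at l)"
      using 2 that unfolding integral_curve_def by auto
    from DERIV_omega_curve[OF d] show ?thesis
      using c by (simp add: xi3_def eta3_def tan_def)
  qed
  from eq_linear_if_DERIV_const[OF L(1,2) this L(3) 2(2)] show ?case by simp
next
  case (3 L X Y l)
  then have L: "open L" "is_interval L" "0 \<in> L" unfolding integral_curve_def by auto
  have "((\<lambda>l. tau (X l) (Y l)) has_real_derivative 1) (at l)" if "l \<in> L" for l
  proof -
    have c: "cos (X l) \<noteq> 0" and s: "sin (X l) \<noteq> 0"
      and d: "(X has_real_derivative - xi3 (X l) (Y l)) (at l)"
        "(Y has_real_derivative - eta3 (X l) (Y l)) (at l)"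
      using 3 that unfolding integral_curve_def by auto
    \<comment> \<open>The numerator of the derivative of \<tau> along the flow equals its
      denominator, so \<tau> grows at unit rate.\<close>
    have "sin (X l) * cos (X l) * cos (Y l) * - eta3 (X l) (Y l) - sin (Y l) * - xi3 (X l) (Y l)
       = (sin (X l))\<^sup>2 * (cos (Y l))\<^sup>2 + (sin (Y l))\<^sup>2"
      using c by (simp add: xi3_def eta3_def tan_def power2_eq_square)
    also have "\<dots> = 1 - (omega (X l) (Y l))\<^sup>2"
      unfolding omega_def using sin_cos_squared_add[of "X l"] sin_cos_squared_add[of "Y l"] by algebra
    finally show ?thesis
      using DERIV_tau_curve[OF d s] one_minus_omega_sq_pos[OF s, of "Y l"] by simp
  qed
  from eq_linear_if_DERIV_const[OF L(1,2) this L(3) 3(2)] show ?case by simp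
qed


section \<open>The first integral\<close>

lemma cos_sq_tau:
  assumes "sin x \<noteq> 0"
  shows "(cos (tau x y))\<^sup>2 = (sin x)\<^sup>2 / (1 - (omega x y)\<^sup>2)"
proof -
  have "(cos (tau x y))\<^sup>2 = 1 / (1 + (cot x * sin y)\<^sup>2)"
    by (simp add: tau_def cos_arctan power_divide)
  also have "1 + (cot x * sin y)\<^sup>2 = (1 - (omega x y)\<^sup>2) / (sin x)\<^sup>2"
    unfolding one_minus_omega_sq using assms by (simp add: cot_def field_simps)
  finally show ?thesis by simp
qed

text \<open>The left side is 1 - (1 - \<omega>^2) cos^2 \<tau>, and the subtracted product is sin^2
  x by \<open>cos_sq_tau\<close>.\<close>

lemma omega_sq_cos_sq_tau:
  assumes "sin x \<noteq> 0"
  shows "(omega x y)\<^sup>2 * (cos (tau x y))\<^sup>2 + (sin (tau x y))\<^sup>2 = (cos x)\<^sup>2"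
proof -
  have "(1 - (omega x y)\<^sup>2) * (cos (tau x y))\<^sup>2 = (sin x)\<^sup>2"
    using one_minus_omega_sq_pos[OF assms, of y] by (simp add: cos_sq_tau[OF assms])
  then show ?thesis
    using sin_cos_squared_add[of x] sin_cos_squared_add[of "tau x y"] by algebra
qed

lemma tan_tau: "tan (tau x y) = cot x * sin y"
  by (simp add: tau_def tan_arctan)

lemma omega_over_tan_tau:
  assumes "cos x \<noteq> 0"
  shows "omega x y / tan (tau x y) = sin x * cot y"
  using assms by (simp add: tan_tau omega_def cot_def)

text \<open>The constant \<open>\<alpha>\<close> of the reduced equation as a function on the space of \<open>(x, y, y')\<close>, obtained by
  equating the radicand with \<open>1 / (1 + (y' cos x)\<^sup>2)\<close>.\<close>

definition first_integral :: "real \<Rightarrow> real \<Rightarrow> real \<Rightarrow> real \<Rightarrow> real" where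
  "first_integral k x y p =
     (cos x)\<^sup>2 + (k / (cos y)\<^sup>2 - (cos x)\<^sup>2) / (1 + (cos x * p)\<^sup>2)"

lemma one_plus_sq_pos: "(1::real) + u\<^sup>2 > 0"
  by (simp add: add_pos_nonneg)

text \<open>The radicand is (\<alpha> - cos^2 x) / \<open>M\<close>, so equating it with 1 /
  \<open>N\<close> and solving for \<alpha> gives cos^2 x + \<open>M\<close> / \<open>N\<close>. The
  condition \<omega>^2 \<noteq> \<open>k\<close> makes \<open>M\<close> nonzero.\<close>

lemma reduced_radicand_eq_iff:
  assumes "sin x \<noteq> 0" "cos x \<noteq> 0" "cos y \<noteq> 0" "(omega x y)\<^sup>2 \<noteq> k"
  shows "reduced_radicand k \<alpha> (tau x y) (omega x y) = 1 / (1 + (cos x * p)\<^sup>2)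
    \<longleftrightarrow> first_integral k x y p = \<alpha>"
proof -
  define N M where "N = 1 + (cos x * p)\<^sup>2" and "M = k / (cos y)\<^sup>2 - (cos x)\<^sup>2"
  have M: "(k / (omega x y)\<^sup>2 - 1) * (cos x)\<^sup>2 = M"
    using assms by (simp add: M_def omega_def field_simps)
  have "M \<noteq> 0" "N \<noteq> 0"
    using assms one_plus_sq_pos[of "cos x * p"] by (auto simp: M_def N_def omega_def field_simps)
  then show ?thesis
    unfolding reduced_radicand_def omega_sq_cos_sq_tau[OF assms(1)] M first_integral_def
      N_def[symmetric] M_def[symmetric]
    by (auto simp: field_simps)
qed

text \<open>The square root is the cosine of \<open>arctan u\<close>, and \<open>arccos\<close>
  recovers the angle only up to sign; this is the origin of the sign in the reduced
  equation.\<close>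

lemma arccos_sqrt_eq_abs_arctan: "arccos (sqrt (1 / (1 + u\<^sup>2))) = \<bar>arctan u\<bar>"
proof -
  have "sqrt (1 / (1 + u\<^sup>2)) = cos \<bar>arctan u\<bar>"
    by (simp add: cos_arctan real_sqrt_divide)
  moreover have "\<bar>arctan u\<bar> \<le> pi"
    using arctan_bounded[of u] pi_gt_zero by linarith
  ultimately show ?thesis
    by (simp only: arccos_cos abs_ge_zero)
qed

text \<open>For nonzero \<open>u\<close> the hypothesis forces \<open>s\<close> to be the sign of
  \<open>u\<close>, which is also the sign of \<open>arctan u\<close>. At \<open>u = 0\<close> any
  \<open>s\<close> is allowed and both sides are 0.\<close>

lemma sgn_abs_arctan:
  assumes "s * \<bar>u\<bar> = u"
  shows "s * \<bar>arctan u\<bar> = arctan u"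
proof (cases u "0::real" rule: linorder_cases)
  case less
  then have "(s + 1) * u = 0" using assms by (simp add: algebra_simps)
  then have "s = - 1" using less by (simp add: add_eq_0_iff)
  then show ?thesis using less by simp
next
  case greater
  then have "s = 1" using assms by simp
  then show ?thesis using greater by simp
qed simp

lemma cos_arctan_add: "cos (arctan a + arctan b) = cos (arctan a) * cos (arctan b) * (1 - a * b)"
proof -
  have "sin (arctan u) = u * cos (arctan u)" for u
    by (simp add: sin_arctan cos_arctan)
  then show ?thesis by (simp add: cos_add algebra_simps)
qed

lemma cos_arctan_add_nonzero_iff: "cos (arctan a + arctan b) \<noteq> 0 \<longleftrightarrow> a * b \<noteq> 1"
  by (simp add: cos_arctan_add)

lemma tan_arctan_add:
  assumes "a * b \<noteq> 1"
  shows "tan (arctan a + arctan b) = (a + b) / (1 - a * b)"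
  using assms by (subst tan_add) (simp_all add: cos_arctan_add_nonzero_iff tan_arctan)

text \<open>The factor in front of \<open>geodesic_lhs\<close> is an integrating factor: it makes
  the equation exact. It vanishes only with \<open>y1 x\<close>.\<close>

lemma DERIV_first_integral:
  assumes y: "(y has_real_derivative y1 x) (at x)" and y1: "(y1 has_real_derivative y2 x) (at x)"
    and c: "cos x \<noteq> 0" and cy: "cos (y x) \<noteq> 0"
  shows "((\<lambda>x. first_integral k x (y x) (y1 x)) has_real_derivative
    2 * cos x * y1 x * geodesic_lhs k x (y x) (y1 x) (y2 x)
      / ((1 + (cos x * y1 x)\<^sup>2)\<^sup>2 * (cos (y x)) ^ 3)) (at x)"
proof -
  define N where "N = 1 + (cos x * y1 x)\<^sup>2"
  define M where "M = k / (cos (y x))\<^sup>2 - (cos x)\<^sup>2"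
  define M' where "M' = 2 * k * sin (y x) * y1 x / (cos (y x)) ^ 3 + 2 * cos x * sin x"
  define N' where "N' = 2 * (cos x * y1 x) * (cos x * y2 x - sin x * y1 x)"
  have N: "N \<noteq> 0" using one_plus_sq_pos[of "cos x * y1 x"] by (simp add: N_def)
  have dM: "((\<lambda>x. k / (cos (y x))\<^sup>2 - (cos x)\<^sup>2) has_real_derivative M') (at x)"
    unfolding M'_def using cy
    by (auto intro!: derivative_eq_intros y simp: field_simps eval_nat_numeral)
  have dN: "((\<lambda>x. 1 + (cos x * y1 x)\<^sup>2) has_real_derivative N') (at x)"
    unfolding N'_def by (auto intro!: derivative_eq_intros y1 simp: algebra_simps power2_eq_square)
  have "((\<lambda>x. (cos x)\<^sup>2) has_real_derivative - 2 * cos x * sin x) (at x)"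
    by (auto intro!: derivative_eq_intros)
  from DERIV_add[OF this DERIV_divide[OF dM dN N[unfolded N_def]]]
  have "((\<lambda>x. first_integral k x (y x) (y1 x)) has_real_derivative
      - 2 * cos x * sin x + (M' * N - M * N') / (N * N)) (at x)"
    by (simp only: first_integral_def N_def M_def)
  moreover have "- 2 * cos x * sin x + (M' * N - M * N') / (N * N)
    = 2 * cos x * y1 x * geodesic_lhs k x (y x) (y1 x) (y2 x) / (N\<^sup>2 * (cos (y x)) ^ 3)"
  proof -
    \<comment> \<open>Replacing \<open>k\<close> by \<open>d * cos x\<close> removes the last
      quotient. What remains is a polynomial identity in the sines and cosines that needs no
      Pythagorean relation.\<close>
    define d where "d = k / cos x"
    have d: "d * cos x = k" using c by (simp add: d_def)
    have 1: "M' * (cos (y x)) ^ 3 = 2 * k * sin (y x) * y1 x + 2 * cos x * sin x * (cos (y x)) ^ 3"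
      using cy by (simp add: M'_def distrib_right)
    have 2: "M * (cos (y x)) ^ 3 = k * cos (y x) - (cos x)\<^sup>2 * (cos (y x)) ^ 3"
      using cy by (simp add: M_def left_diff_distrib power2_eq_square power3_eq_cube)
    have "(- 2 * cos x * sin x * N\<^sup>2 + (M' * N - M * N')) * (cos (y x)) ^ 3
       = - 2 * cos x * sin x * N\<^sup>2 * (cos (y x)) ^ 3 + (M' * (cos (y x)) ^ 3) * N - (M * (cos (y x)) ^ 3) * N'"
      by (simp add: algebra_simps)
    also have "\<dots> = 2 * cos x * y1 x * geodesic_lhs k x (y x) (y1 x) (y2 x)"
      unfolding 1 2 N_def N'_def geodesic_lhs_def d_def[symmetric] d[symmetric]
      by (simp add: algebra_simps eval_nat_numeral)
    finally show ?thesis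
      using N cy by (simp add: field_simps power2_eq_square)
  qed
  ultimately show ?thesis by (simp add: N_def)
qed


section \<open>Reduction along a curve\<close>

text \<open>The derivative of \<open>\<omega>\<close> with respect to \<open>\<tau>\<close> along a curve with \<open>y' = p\<close>.\<close>

definition slope :: "real \<Rightarrow> real \<Rightarrow> real \<Rightarrow> real" where
  "slope x y p = (1 - (omega x y)\<^sup>2) * tan (arctan (cos x * p) + arctan (sin x * cot y))"

text \<open>Uniqueness of the derivative of \<open>w\<close> equates two tangents, so the angles
  agree modulo pi. Their ranges force equality, and the squared cosines then give the
  radicand.\<close>

lemma reduced_eq_at_imp_first_integral:
  assumes eq: "reduced_eq_at k \<alpha> s w (tau x y)" and s: "s \<in> {1, -1}"
    and w: "w (tau x y) = omega x y" "(w has_real_derivative slope x y p) (at (tau x y))"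
    and x: "sin x \<noteq> 0" "cos x \<noteq> 0" and y: "cos y \<noteq> 0" and k: "(omega x y)\<^sup>2 \<noteq> k"
    and nz: "(cos x * p) * (sin x * cot y) \<noteq> 1"
  shows "first_integral k x y p = \<alpha>"
proof -
  define R where "R = reduced_radicand k \<alpha> (tau x y) (omega x y)"
  define \<theta> where "\<theta> = s * arccos (sqrt R)"
  let ?a = "arctan (cos x * p)" and ?b = "arctan (sin x * cot y)"
  have ang: "reduced_angle k \<alpha> s (tau x y) (omega x y) = \<theta> + ?b"
    by (simp add: reduced_angle_def omega_over_tan_tau[OF x(2)] \<theta>_def R_def)
  have R: "0 \<le> R" "R \<le> 1" and c1: "cos (\<theta> + ?b) \<noteq> 0"
    and "(w has_real_derivative (1 - (omega x y)\<^sup>2) * tan (\<theta> + ?b)) (at (tau x y))"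
    using eq by (simp_all add: reduced_eq_at_def w(1) ang R_def)
  from DERIV_unique[OF this(4) w(2)] have "tan (\<theta> + ?b) = tan (?a + ?b)"
    using one_minus_omega_sq_pos[OF x(1), of y] by (simp add: slope_def)
  \<comment> \<open>Both cosines must be nonzero before equal tangents say anything, because
    \<open>tan\<close> takes the value 0 at its poles.\<close>
  moreover have c2: "cos (?a + ?b) \<noteq> 0"
    using nz by (simp add: cos_arctan_add_nonzero_iff)
  ultimately have "sin ((\<theta> + ?b) - (?a + ?b)) = 0"
    using c1 unfolding sin_diff tan_def by (simp add: field_simps)
  then have sin: "sin (\<theta> - ?a) = 0" by simp
  \<comment> \<open>A nonnegative argument keeps \<open>arccos\<close> within pi/2, while
    \<open>arctan\<close> stays strictly within it; the difference is therefore strictly between -pi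
    and pi.\<close>
  have "\<bar>\<theta>\<bar> \<le> pi / 2"
    using R s arccos_le_pi2[of "sqrt R"] arccos_lbound[of "sqrt R"] order_trans[of "-1" 0 "sqrt R"]
    by (auto simp: \<theta>_def)
  with arctan_bounded[of "cos x * p"] have "- pi < \<theta> - ?a" "\<theta> - ?a < pi"
    by linarith+
  from sin_eq_0_pi[OF this sin] have "\<theta> - ?a = 0" .
  then have "cos \<theta> = cos ?a" by simp
  moreover have "cos \<theta> = sqrt R"
    using s R cos_arccos[of "sqrt R"] order_trans[of "-1" 0 "sqrt R"] by (auto simp: \<theta>_def)
  ultimately have "(sqrt R)\<^sup>2 = (cos ?a)\<^sup>2" by simp
  then have "R = 1 / (1 + (cos x * p)\<^sup>2)"
    using R by (simp add: cos_arctan power_divide)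
  then show ?thesis
    using reduced_radicand_eq_iff[OF x y k] by (simp add: R_def)
qed

text \<open>The value of the first integral fixes the radicand. With \<open>s\<close> the sign of
  \<open>cos x * p\<close>, the reduced angle is then the very angle in
  \<open>slope\<close>.\<close>

lemma reduced_eq_atI:
  assumes fi: "first_integral k x y p = \<alpha>" and s: "s * \<bar>cos x * p\<bar> = cos x * p"
    and w: "w (tau x y) = omega x y" "(w has_real_derivative slope x y p) (at (tau x y))"
    and x: "sin x \<noteq> 0" "cos x \<noteq> 0" and y: "sin y \<noteq> 0" "cos y \<noteq> 0" and k: "(omega x y)\<^sup>2 \<noteq> k"
    and nz: "(cos x * p) * (sin x * cot y) \<noteq> 1"
  shows "reduced_eq_at k \<alpha> s w (tau x y)"
proof -
  have R: "reduced_radicand k \<alpha> (tau x y) (omega x y) = 1 / (1 + (cos x * p)\<^sup>2)"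
    using reduced_radicand_eq_iff[OF x y(2) k] fi by simp
  have ang: "reduced_angle k \<alpha> s (tau x y) (omega x y) = arctan (cos x * p) + arctan (sin x * cot y)"
    unfolding reduced_angle_def R arccos_sqrt_eq_abs_arctan sgn_abs_arctan[OF s]
      omega_over_tan_tau[OF x(2)] by simp
  have "0 \<le> 1 / (1 + (cos x * p)\<^sup>2)" "1 / (1 + (cos x * p)\<^sup>2) \<le> 1"
    using one_plus_sq_pos[of "cos x * p"] by (auto simp: field_simps)
  moreover have "tan (tau x y) \<noteq> 0" using x y by (simp add: tan_tau cot_def)
  moreover have "omega x y \<noteq> 0" using x y by (simp add: omega_def)
  moreover have "cos (arctan (cos x * p) + arctan (sin x * cot y)) \<noteq> 0"
    using nz by (simp add: cos_arctan_add_nonzero_iff)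
  ultimately show ?thesis
    unfolding reduced_eq_at_def w(1) R ang omega_sq_cos_sq_tau[OF x(1)]
    using x k w(2) by (simp add: slope_def)
qed

text \<open>The right side is the quotient of the x-derivatives of \<omega> and \<tau>. Clearing
  \<open>sin y\<close> in the addition formula for the tangent shows this, and shows that a pole of
  the tangent would be a zero of the derivative of \<tau>.\<close>

lemma slope_eq:
  assumes "sin y \<noteq> 0" "sin x * cos x * cos y * p - sin y \<noteq> 0"
  shows "(cos x * p) * (sin x * cot y) \<noteq> 1"
    and "slope x y p =
      (- sin x * cos y - cos x * sin y * p) / ((sin x * cos x * cos y * p - sin y) / (1 - (omega x y)\<^sup>2))"
proof -
  have e: "(1 - (cos x * p) * (sin x * cot y)) * sin y = - (sin x * cos x * cos y * p - sin y)"
    and e': "(cos x * p + sin x * cot y) * sin y = - (- sin x * cos y - cos x * sin y * p)"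
    using assms(1) by (simp_all add: cot_def field_simps)
  then show nz: "(cos x * p) * (sin x * cot y) \<noteq> 1"
    using assms(2) by auto
  have "(cos x * p + sin x * cot y) / (1 - (cos x * p) * (sin x * cot y))
     = ((cos x * p + sin x * cot y) * sin y) / ((1 - (cos x * p) * (sin x * cot y)) * sin y)"
    using assms(1) by simp
  also have "\<dots> = (- sin x * cos y - cos x * sin y * p) / (sin x * cos x * cos y * p - sin y)"
    unfolding e e' by (simp only: minus_divide_divide)
  finally show "slope x y p =
      (- sin x * cos y - cos x * sin y * p) / ((sin x * cos x * cos y * p - sin y) / (1 - (omega x y)\<^sup>2))"
    unfolding slope_def tan_arctan_add[OF nz] by simp
qed

section \<open>Sign and injectivity on an interval\<close>

lemma interval_nonvanishing_sign:
  fixes g :: "real \<Rightarrow> real"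
  assumes "is_interval I" "continuous_on I g" "\<And>x. x \<in> I \<Longrightarrow> g x \<noteq> 0"
  obtains s :: real where "s \<in> {1, -1}" "\<And>x. x \<in> I \<Longrightarrow> s * \<bar>g x\<bar> = g x"
proof -
  have i: "is_interval (g ` I)"
    using assms by (simp add: is_interval_connected_1 connected_continuous_image)
  have "(\<forall>x\<in>I. 0 < g x) \<or> (\<forall>x\<in>I. g x < 0)"
  proof (rule ccontr)
    assume "\<not> ?thesis"
    then obtain a b where "a \<in> I" "b \<in> I" "g a \<le> 0" "0 \<le> g b"
      by (auto simp: not_less)
    then have "0 \<in> g ` I"
      using i by (meson imageI mem_is_interval_1_I)
    with assms(3) show False by auto
  qed
  then show thesis
  proof
    assume "\<forall>x\<in>I. 0 < g x"
    then show thesis by (intro that[of 1]) auto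
  next
    assume "\<forall>x\<in>I. g x < 0"
    then show thesis by (intro that[of "-1"]) (auto simp: abs_of_neg)
  qed
qed

text \<open>By the mean value theorem, equal values at two points would give a zero of the
  derivative. This makes the inverse inside \<open>omega_of_tau\<close> meaningful.\<close>

lemma inj_on_interval_if_DERIV_nonzero:
  fixes f :: "real \<Rightarrow> real"
  assumes I: "is_interval I"
    and d: "\<And>x. x \<in> I \<Longrightarrow> (f has_real_derivative f' x) (at x)" "\<And>x. x \<in> I \<Longrightarrow> f' x \<noteq> 0"
  shows "inj_on f I"
proof (rule linorder_inj_onI')
  fix a b assume ab: "a \<in> I" "b \<in> I" "a < b"
  have sub: "z \<in> I" if "a \<le> z" "z \<le> b" for z
    using I ab that unfolding is_interval_1 by blast
  obtain z where "a < z" "z < b" "f b - f a = (b - a) * f' z"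
    using MVT2[OF ab(3), of f f'] d(1) sub by blast
  moreover from this have "f' z \<noteq> 0" using d(2) sub by simp
  ultimately show "f a \<noteq> f b" using ab(3) by auto
qed

section \<open>Admissible curves\<close>

locale admissible =
  fixes k :: real and I :: "real set" and y y1 y2 :: "real \<Rightarrow> real"
  assumes adm: "admissible_curve k I y y1 y2"
begin

lemma open_I: "open I" and interval_I: "is_interval I"
  using adm by (auto simp: admissible_curve_def)

lemma
  assumes "x \<in> I"
  shows DERIV_y: "(y has_real_derivative y1 x) (at x)"
    and DERIV_y1: "(y1 has_real_derivative y2 x) (at x)"
    and nonzero: "sin x \<noteq> 0" "cos x \<noteq> 0" "sin (y x) \<noteq> 0" "cos (y x) \<noteq> 0"
    and omega_sq: "(omega x (y x))\<^sup>2 \<noteq> k"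
  using adm assms by (auto simp: admissible_curve_def)

definition dtau :: "real \<Rightarrow> real" where
  "dtau x = (sin x * cos x * cos (y x) * y1 x - sin (y x)) / (1 - (omega x (y x))\<^sup>2)"

lemma DERIV_tau:
  assumes "x \<in> I"
  shows "((\<lambda>u. tau u (y u)) has_real_derivative dtau x) (at x)" and "dtau x \<noteq> 0"
proof -
  show *: "((\<lambda>u. tau u (y u)) has_real_derivative dtau x) (at x)"
    using DERIV_tau_curve[OF DERIV_ident DERIV_y[OF assms] nonzero(1)[OF assms]]
    by (simp add: dtau_def)
  show "dtau x \<noteq> 0"
    using DERIV_imp_deriv[OF *] adm assms by (auto simp: admissible_curve_def)
qed

lemma inj_tau: "inj_on (\<lambda>x. tau x (y x)) I"
  using inj_on_interval_if_DERIV_nonzero[OF interval_I] DERIV_tau by blast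

lemma omega_of_tau_tau:
  assumes "x \<in> I"
  shows "omega_of_tau I y (tau x (y x)) = omega x (y x)"
  using the_inv_into_f_f[OF inj_tau assms] by (simp add: omega_of_tau_def)

lemma nonsingular: "x \<in> I \<Longrightarrow> (cos x * y1 x) * (sin x * cot (y x)) \<noteq> 1"
  using slope_eq(1)[OF nonzero(3)] DERIV_tau(2) by (auto simp: dtau_def)

lemma DERIV_omega_of_tau:
  assumes x: "x \<in> I"
  shows "(omega_of_tau I y has_real_derivative slope x (y x) (y1 x)) (at (tau x (y x)))"
proof -
  let ?F = "\<lambda>u. tau u (y u)" and ?g = "the_inv_into I (\<lambda>u. tau u (y u))"
  have cont: "continuous_on I ?F"
    using DERIV_tau(1) DERIV_isCont by (blast intro: continuous_at_imp_continuous_on)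
  \<comment> \<open>The inverse function theorem asks for a right inverse of the derivative as a
    linear map, here multiplication by the reciprocal of \<open>dtau x\<close>.\<close>
  have "(*) (dtau x) \<circ> (*) (inverse (dtau x)) = id"
    using DERIV_tau(2)[OF x] by (simp add: fun_eq_iff)
  then have g: "(?g has_real_derivative inverse (dtau x)) (at (?F x))"
    using has_derivative_inverse_strong[OF open_I x cont the_inv_into_f_f[OF inj_tau]
        DERIV_tau(1)[OF x, unfolded has_field_derivative_def]]
    unfolding has_field_derivative_def by blast
  have "((\<lambda>u. omega u (y u)) has_real_derivative
      - sin x * cos (y x) - cos x * sin (y x) * y1 x) (at (?g (?F x)))"
    using DERIV_omega_curve[OF DERIV_ident DERIV_y[OF x]] the_inv_into_f_f[OF inj_tau x] by simp
  from DERIV_chain2[OF this g]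
  have "(omega_of_tau I y has_real_derivative
      (- sin x * cos (y x) - cos x * sin (y x) * y1 x) / dtau x) (at (?F x))"
    unfolding omega_of_tau_def Let_def by (simp only: divide_inverse)
  moreover have "sin x * cos x * cos (y x) * y1 x - sin (y x) \<noteq> 0"
    using DERIV_tau(2)[OF x] by (auto simp: dtau_def)
  ultimately show ?thesis
    using slope_eq(2)[OF nonzero(3)[OF x]] by (simp add: dtau_def)
qed

lemma DERIV_first_integral_curve:
  assumes "x \<in> I"
  shows "((\<lambda>x. first_integral k x (y x) (y1 x)) has_real_derivative
    2 * cos x * y1 x * geodesic_lhs k x (y x) (y1 x) (y2 x)
      / ((1 + (cos x * y1 x)\<^sup>2)\<^sup>2 * (cos (y x)) ^ 3)) (at x)"
  by (rule DERIV_first_integral) (use assms DERIV_y DERIV_y1 nonzero in blast)+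

lemma solves_geodesic_imp_first_integral_const:
  assumes "solves_geodesic k I y y1 y2"
  shows "\<exists>\<alpha>. \<forall>x\<in>I. first_integral k x (y x) (y1 x) = \<alpha>"
proof -
  have "((\<lambda>x. first_integral k x (y x) (y1 x)) has_real_derivative 0) (at x)" if "x \<in> I" for x
    using DERIV_first_integral_curve[OF that] that assms by (simp add: solves_geodesic_def)
  then have "(\<lambda>x. first_integral k x (y x) (y1 x)) constant_on I"
    using open_I interval_I by (intro has_field_derivative_0_imp_constant_on) (auto simp: is_interval_connected)
  then show ?thesis unfolding constant_on_def .
qed

lemma reduced_eq_at_tau:
  assumes "x \<in> I" "first_integral k x (y x) (y1 x) = \<alpha>" "s * \<bar>cos x * y1 x\<bar> = cos x * y1 x"
  shows "reduced_eq_at k \<alpha> s (omega_of_tau I y) (tau x (y x))"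
  using assms nonzero[OF assms(1)] omega_sq[OF assms(1)] nonsingular[OF assms(1)]
    omega_of_tau_tau[OF assms(1)] DERIV_omega_of_tau[OF assms(1)]
  by (intro reduced_eq_atI)

lemma solves_geodesic_imp_solves_reduced:
  assumes "solves_geodesic k I y y1 y2"
  shows "\<exists>\<alpha>. solves_reduced k \<alpha> (tau_image I y) (omega_of_tau I y)"
proof -
  obtain \<alpha> where \<alpha>: "\<And>x. x \<in> I \<Longrightarrow> first_integral k x (y x) (y1 x) = \<alpha>"
    using solves_geodesic_imp_first_integral_const[OF assms] by blast
  have "\<exists>s\<in>{1, -1}. reduced_eq_at k \<alpha> s (omega_of_tau I y) (tau x (y x))" if "x \<in> I" for x
  \<comment> \<open>The sign is chosen point by point; where \<open>y1 x\<close> vanishes, 1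
    serves.\<close>
  proof (cases "cos x * y1 x \<ge> 0")
    case True
    then show ?thesis using reduced_eq_at_tau[OF that \<alpha>[OF that], of 1] by simp
  next
    case False
    then show ?thesis using reduced_eq_at_tau[OF that \<alpha>[OF that], of "-1"] by simp
  qed
  then show ?thesis unfolding solves_reduced_def tau_image_def by blast
qed

lemma solves_geodesic_imp_solves_reduced_sign:
  assumes "solves_geodesic k I y y1 y2" and "\<forall>x\<in>I. y1 x \<noteq> 0"
  shows "\<exists>\<alpha>. \<exists>s\<in>{1, -1}. solves_reduced_sign k \<alpha> s (tau_image I y) (omega_of_tau I y)"
proof -
  obtain \<alpha> where \<alpha>: "\<And>x. x \<in> I \<Longrightarrow> first_integral k x (y x) (y1 x) = \<alpha>"
    using solves_geodesic_imp_first_integral_const[OF assms(1)] by blast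
  \<comment> \<open>\<open>y1\<close> is differentiable, hence continuous, so
    \<open>cos x * y1 x\<close> cannot change sign without vanishing: one sign serves the whole
    curve.\<close>
  have "continuous_on I y1"
    using DERIV_y1 DERIV_isCont by (blast intro: continuous_at_imp_continuous_on)
  then have cont: "continuous_on I (\<lambda>x. cos x * y1 x)"
    by (intro continuous_intros)
  have "cos x * y1 x \<noteq> 0" if "x \<in> I" for x
    using assms(2) nonzero(2) that by simp
  from interval_nonvanishing_sign[OF interval_I cont this]
  obtain s :: real where "s \<in> {1, -1}" and s: "\<And>x. x \<in> I \<Longrightarrow> s * \<bar>cos x * y1 x\<bar> = cos x * y1 x"
    by metis
  moreover have "solves_reduced_sign k \<alpha> s (tau_image I y) (omega_of_tau I y)"
    using reduced_eq_at_tau[OF _ \<alpha> s] by (auto simp: solves_reduced_sign_def tau_image_def)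
  ultimately show ?thesis by blast
qed

lemma solves_reduced_imp_solves_geodesic:
  assumes cont: "continuous_on I y2" and nlc: "nowhere_locally_constant I y"
    and red: "solves_reduced k \<alpha> (tau_image I y) (omega_of_tau I y)"
  shows "solves_geodesic k I y y1 y2"
proof -
  let ?F = "\<lambda>x. geodesic_lhs k x (y x) (y1 x) (y2 x)"
  \<comment> \<open>The sign may vary with the point, but \<alpha> is common to all points, so the
    first integral is constant.\<close>
  have fi: "first_integral k x (y x) (y1 x) = \<alpha>" if x: "x \<in> I" for x
  proof -
    obtain s where s: "s \<in> {1, -1}" "reduced_eq_at k \<alpha> s (omega_of_tau I y) (tau x (y x))"
      using red x unfolding solves_reduced_def tau_image_def by blast
    show ?thesis
      by (rule reduced_eq_at_imp_first_integral[OF s(2,1) omega_of_tau_tau[OF x] DERIV_omega_of_tau[OF x]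
            nonzero(1,2)[OF x] nonzero(4)[OF x] omega_sq[OF x] nonsingular[OF x]])
  qed
  \<comment> \<open>The derivative of this constant is zero, and its only factors that can vanish
    are \<open>y1 x\<close> and the left-hand side of the equation.\<close>
  have pF: "y1 x = 0" if x: "x \<in> I" and F: "?F x \<noteq> 0" for x
  proof -
    have "((\<lambda>x. first_integral k x (y x) (y1 x)) has_real_derivative 0) (at x)"
      by (rule has_field_derivative_transform_within_open[OF DERIV_const open_I x]) (simp add: fi)
    from DERIV_unique[OF this DERIV_first_integral_curve[OF x]]
    show ?thesis
      using F nonzero(2,4)[OF x] one_plus_sq_pos[of "cos x * y1 x"] by auto
  qed
  have "continuous_on I y" "continuous_on I y1"
    using DERIV_y DERIV_y1 DERIV_isCont by (blast intro: continuous_at_imp_continuous_on)+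
  then have "continuous_on I ?F"
    unfolding geodesic_lhs_def using cont nonzero(2) by (intro continuous_intros) auto
  \<comment> \<open>Continuity of \<open>y2\<close> enters here: a failure of the equation at one
    point spreads to a ball, on which \<open>y1\<close> vanishes and \<open>y\<close> is
    constant.\<close>
  then have op: "open {x \<in> I. ?F x \<noteq> 0}"
    using continuous_open_preimage[OF _ open_I, of ?F "- {0}"]
    by (simp add: vimage_def Int_def Collect_neg_eq open_Compl)
  have "?F x = 0" if x: "x \<in> I" for x
  proof (rule ccontr)
    assume "?F x \<noteq> 0"
    then obtain e where e: "e > 0" "ball x e \<subseteq> {x \<in> I. ?F x \<noteq> 0}"
      using op x by (metis (mono_tags, lifting) mem_Collect_eq openE)
    have ball: "ball x e = {x - e<..<x + e}" by (simp add: ball_eq_greaterThanLessThan)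
    have "(y has_real_derivative 0) (at z)" if "z \<in> ball x e" for z
      using DERIV_y[of z] pF[of z] e that by auto
    then have "y constant_on ball x e"
      by (intro has_field_derivative_0_imp_constant_on) auto
    moreover have "ball x e \<subseteq> I" "x - e < x + e" using e by auto
    ultimately show False
      using nlc unfolding nowhere_locally_constant_def ball by blast
  qed
  then show ?thesis by (simp add: solves_geodesic_def)
qed

end


section \<open>Assembly of symmetry, coordinates and reduction\<close>

theorem mainTheorem3:
  fixes k :: real
  assumes "0 \<le> k" and "k \<le> 1"
  shows
    "lie_point_symmetry {(x, y). cos x \<noteq> 0} (geodesic_lhs k) xi3 eta3 \<and>
     canonical_coordinates {(x, y). sin x \<noteq> 0 \<and> cos x \<noteq> 0}
       (\<lambda>x y. - xi3 x y) (\<lambda>x y. - eta3 x y) tau omega \<and>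
     (\<forall>I y y1 y2. admissible_curve k I y y1 y2 \<longrightarrow>
        inj_on (\<lambda>x. tau x (y x)) I \<and>
        (solves_geodesic k I y y1 y2 \<longrightarrow>
           (\<exists>\<alpha>. solves_reduced k \<alpha> (tau_image I y) (omega_of_tau I y))) \<and>
        (solves_geodesic k I y y1 y2 \<and> (\<forall>x\<in>I. y1 x \<noteq> 0) \<longrightarrow>
           (\<exists>\<alpha>. \<exists>s\<in>{1, -1}.
              solves_reduced_sign k \<alpha> s (tau_image I y) (omega_of_tau I y))) \<and>
        (continuous_on I y2 \<and> nowhere_locally_constant I y \<and>
         (\<exists>\<alpha>. solves_reduced k \<alpha> (tau_image I y) (omega_of_tau I y)) \<longrightarrow>
           solves_geodesic k I y y1 y2))"
proof (intro conjI allI impI)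
  show "lie_point_symmetry {(x, y). cos x \<noteq> 0} (geodesic_lhs k) xi3 eta3"
    unfolding lie_point_symmetry_def by (auto simp: chi3_prolonged_geodesic_lhs)
  show "canonical_coordinates {(x, y). sin x \<noteq> 0 \<and> cos x \<noteq> 0}
      (\<lambda>x y. - xi3 x y) (\<lambda>x y. - eta3 x y) tau omega"
    by (rule canonical_coordinates_tau_omega)
next
  fix I y y1 y2
  assume "admissible_curve k I y y1 y2"
  then interpret admissible k I y y1 y2 by unfold_locales
  show "inj_on (\<lambda>x. tau x (y x)) I" by (rule inj_tau)
  show "\<exists>\<alpha>. solves_reduced k \<alpha> (tau_image I y) (omega_of_tau I y)"
    if "solves_geodesic k I y y1 y2"
    using solves_geodesic_imp_solves_reduced[OF that] .
  show "\<exists>\<alpha>. \<exists>s\<in>{1, -1}. solves_reduced_sign k \<alpha> s (tau_image I y) (omega_of_tau I y)"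
    if "solves_geodesic k I y y1 y2 \<and> (\<forall>x\<in>I. y1 x \<noteq> 0)"
    using that solves_geodesic_imp_solves_reduced_sign by blast
  show "solves_geodesic k I y y1 y2"
    if "continuous_on I y2 \<and> nowhere_locally_constant I y \<and>
      (\<exists>\<alpha>. solves_reduced k \<alpha> (tau_image I y) (omega_of_tau I y))"
    using that solves_reduced_imp_solves_geodesic by blast
qed

end
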